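(* Let $\mathcal{K}\subset\mathbb{R}^n$ be a proper subdual cone, let $\mathcal{C}=\mathbb{S}^{n-1}\cap\operatorname{int}(\mathcal{K})$, and let $A=A^{\top}\in\mathbb{R}^{n\times n}$. Define $q_A:\mathcal{C}\to\mathbb{R}$ by $q_A(x)=\langle Ax,x\rangle$ and $\varphi_A:\operatorname{int}(\mathcal{K})\to\mathbb{R}$ by $\varphi_A(x)=\langle Ax,x\rangle/\|x\|^2$. Then $q_A$ is spherically quasi-convex if and only if $\varphi_A$ is quasi-convex (in the usual sense, on the convex set $\operatorname{int}(\mathcal{K})$).
   Context: $\langle\cdot,\cdot\rangle$ and $\|\cdot\|$ are the canonical inner product and norm on $\mathbb{R}^n$; $\mathbb{S}^{n-1}=\{x\in\mathbb{R}^n:\|x\|=1\}$ with intrinsic distance $d(x,y)=\arccos\langle x,y\rangle$. A cone is a set invariant under multiplication by positive scalars. A proper cone is a closed convex cone with nonempty interior which is pointed ($\mathcal{K}\cap(-\mathcal{K})\subseteq\{0\}$). The dual cone is $\mathcal{K}^*=\{x\in\mathbb{R}^n:\langle x,y\rangle\ge 0\ \forall y\in\mathcal{K}\}$, and $\mathcal{K}$ is subdual if $\mathcal{K}\subset\mathcal{K}^*$. A minimal geodesic segment is a constant-speed parametrized arc of a great circle whose length equals the distance $d$ between its endpoints. A set $\mathcal{C}\subseteq\mathbb{S}^{n-1}$ is spherically convex if for any $x,y\in\mathcal{C}$ all minimal geodesic segments joining $x$ to $y$ are contained in $\mathcal{C}$; the set $\mathcal{C}=\mathbb{S}^{n-1}\cap\operatorname{int}(\mathcal{K})$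 is spherically convex. A function $f:\mathcal{C}\to\mathbb{R}$ on a spherically convex set is spherically quasi-convex if for every minimal geodesic segment $\gamma:I\to\mathcal{C}$ ($I\subset\mathbb{R}$ an interval), $f(\gamma(t))\le\max\{f(\gamma(t_1)),f(\gamma(t_2))\}$ for all $t\in[t_1,t_2]\subset I$. *)

theory Defs
  imports "HOL-Analysis.Analysis"
begin

(* Invariance under strictly positive scalars only; the library predicates cone and conic
   use all nonnegative scalars. *)
definition pos_cone :: "'a::real_vector set \<Rightarrow> bool" where
  "pos_cone K \<longleftrightarrow> (\<forall>x\<in>K. \<forall>c>0. c *\<^sub>R x \<in> K)"

definition proper_cone :: "'a::real_normed_vector set \<Rightarrow> bool" where
  "proper_cone K \<longleftrightarrow>
     pos_cone K \<and> closed K \<and> convex K \<and> interior K \<noteq> {} \<and> K \<inter> uminus ` K \<subseteq> {0}"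

definition dual_cone :: "'a::real_inner set \<Rightarrow> 'a set" where
  "dual_cone K = {x. \<forall>y\<in>K. x \<bullet> y \<ge> 0}"

definition subdual :: "'a::real_inner set \<Rightarrow> bool" where
  "subdual K \<longleftrightarrow> K \<subseteq> dual_cone K"

definition sphere_dist :: "'a::real_inner \<Rightarrow> 'a \<Rightarrow> real" where
  "sphere_dist x y = arccos (x \<bullet> y)"

(* A great circle is the unit circle of a plane with orthonormal basis u, v. The curve below
   traverses it on {a..b} with constant speed w, so its length is w * (b - a). Values of g
   outside {a..b} are irrelevant, and constant curves (w = 0 or a = b) are allowed. *)
definition minimal_geodesic_segment :: "(real \<Rightarrow> 'a::real_inner) \<Rightarrow> real \<Rightarrow> real \<Rightarrow> bool" where
  "minimal_geodesic_segment g a b \<longleftrightarrow> a \<le> b \<and>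
     (\<exists>u v w. norm u = 1 \<and> norm v = 1 \<and> u \<bullet> v = 0 \<and> w \<ge> 0 \<and>
        (\<forall>t\<in>{a..b}. g t = cos (w * (t - a)) *\<^sub>R u + sin (w * (t - a)) *\<^sub>R v) \<and>
        w * (b - a) = sphere_dist (g a) (g b))"

definition spherically_convex :: "'a::real_inner set \<Rightarrow> bool" where
  "spherically_convex C \<longleftrightarrow> C \<subseteq> sphere 0 1 \<and>
     (\<forall>x\<in>C. \<forall>y\<in>C. \<forall>g a b. minimal_geodesic_segment g a b \<and> g a = x \<and> g b = y \<longrightarrow>
        g ` {a..b} \<subseteq> C)"

(* As in convex_on, convexity of the domain is part of both quasi-convexity predicates. *)

definition spherically_quasiconvex_on :: "'a::real_inner set \<Rightarrow> ('a \<Rightarrow> real) \<Rightarrow> bool" where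
  "spherically_quasiconvex_on C f \<longleftrightarrow> spherically_convex C \<and>
     (\<forall>g a b. minimal_geodesic_segment g a b \<and> g ` {a..b} \<subseteq> C \<longrightarrow>
        (\<forall>t1 t2. {t1..t2} \<subseteq> {a..b} \<longrightarrow>
           (\<forall>t\<in>{t1..t2}. f (g t) \<le> max (f (g t1)) (f (g t2)))))"

definition quasiconvex_on :: "'a::real_vector set \<Rightarrow> ('a \<Rightarrow> real) \<Rightarrow> bool" where
  "quasiconvex_on S f \<longleftrightarrow> convex S \<and>
     (\<forall>x\<in>S. \<forall>y\<in>S. \<forall>u\<ge>0. \<forall>v\<ge>0. u + v = 1 \<longrightarrow> f (u *\<^sub>R x + v *\<^sub>R y) \<le> max (f x) (f y))"

definition quad_form :: "real^'n^'n \<Rightarrow> real^'n \<Rightarrow> real" where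
  "quad_form A x = (A *v x) \<bullet> x"

definition rayleigh :: "real^'n^'n \<Rightarrow> real^'n \<Rightarrow> real" where
  "rayleigh A x = ((A *v x) \<bullet> x) / (norm x)\<^sup>2"

end

theory Submission
  imports Defs
begin

text \<open>Central projection of \<open>interior K - {0}\<close> to the sphere is constant on rays, and so is the
  Rayleigh quotient, which restricts to the quadratic form on the sphere. The projection maps line
  segments onto minimal geodesic segments; subduality makes every geodesic in question of length at
  most \<open>pi / 2\<close>, so each of its points is a nonnegative linear combination of the end points.\<close>

section \<open>Great circle arcs and nonnegative combinations\<close>

text \<open>Three vectors in one plane are linearly dependent, with their 2x2 determinants as
  coefficients; for points of a circle these are sines of angle differences. If \<open>r\<close>,
  \<open>s\<close>, \<open>t\<close> are ordered and span an angle below \<open>pi\<close>, no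
  coefficient is negative.\<close>

lemma great_circle_combination:
  fixes u v :: "'a::real_vector"
  shows "sin (t - r) *\<^sub>R (cos s *\<^sub>R u + sin s *\<^sub>R v) =
    sin (t - s) *\<^sub>R (cos r *\<^sub>R u + sin r *\<^sub>R v) + sin (s - r) *\<^sub>R (cos t *\<^sub>R u + sin t *\<^sub>R v)"
proof -
  have "sin (t - r) * cos s = sin (t - s) * cos r + sin (s - r) * cos t"
    by (simp add: sin_diff algebra_simps)
  moreover have "sin (t - r) * sin s = sin (t - s) * sin r + sin (s - r) * sin t"
    by (simp add: sin_diff algebra_simps)
  ultimately show ?thesis
    by (simp add: scaleR_add_right flip: scaleR_add_left)
       (simp add: algebra_simps)
qed

lemma norm_minimal_geodesic_segment:
  assumes "minimal_geodesic_segment g a b" "t \<in> {a..b}"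
  shows "norm (g t) = 1"
proof -
  obtain u v w where "norm u = 1" "norm v = 1" "u \<bullet> v = 0"
    "g t = cos (w * (t - a)) *\<^sub>R u + sin (w * (t - a)) *\<^sub>R v"
    using assms by (auto simp: minimal_geodesic_segment_def)
  then show ?thesis
    by (simp add: norm_eq_1 inner_add_left inner_add_right inner_commute flip: power2_eq_square)
qed

text \<open>The nonnegative inner product bounds the length by \<open>pi / 2\<close>, so the sines
  in the linear relation have the right sign. The parameters \<open>r\<close> and \<open>t\<close>
  need not be the ends of the domain, since quasi-convexity is tested on subintervals.\<close>

lemma minimal_geodesic_segment_combination:
  assumes g: "minimal_geodesic_segment g a b" and ge: "g a \<bullet> g b \<ge> 0"
    and t: "a \<le> r" "r \<le> s" "s \<le> t" "t \<le> b"
  obtains "g s = g r"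
  | c d e where "c > 0" "d \<ge> 0" "e \<ge> 0" "c *\<^sub>R g s = d *\<^sub>R g r + e *\<^sub>R g t"
proof -
  from g obtain u v w where w: "w \<ge> 0"
    and eq: "\<And>t. t \<in> {a..b} \<Longrightarrow> g t = cos (w * (t - a)) *\<^sub>R u + sin (w * (t - a)) *\<^sub>R v"
    and len: "w * (b - a) = sphere_dist (g a) (g b)" and "a \<le> b"
    by (auto simp: minimal_geodesic_segment_def)
  have "g a \<bullet> g b \<le> 1"
    using norm_cauchy_schwarz[of "g a" "g b"] \<open>a \<le> b\<close>
    by (simp add: norm_minimal_geodesic_segment[OF g])
  then have "w * (b - a) \<le> pi / 2"
    using ge arccos_le_pi2 len by (simp add: sphere_dist_def)
  moreover have "w * (t - r) \<le> w * (b - a)"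
    using w t by (intro mult_left_mono) auto
  ultimately have le: "w * (t - r) < pi"
    using pi_gt_zero by linarith
  \<comment> \<open>\<open>f x\<close> is the angle on the great circle at parameter
    \<open>x\<close>.\<close>
  define f where "f x = w * (x - a)" for x
  have mono: "f r \<le> f s" "f s \<le> f t"
    using w t by (auto simp: f_def mult_left_mono)
  have diff: "f t - f r < pi"
    using le by (simp add: f_def algebra_simps)
  have gf: "g x = cos (f x) *\<^sub>R u + sin (f x) *\<^sub>R v" if "x \<in> {r, s, t}" for x
    using that t eq[of x] by (auto simp: f_def)
  show thesis
  \<comment> \<open>Equal angles arise from zero speed or \<open>r = t\<close>; the leading
    coefficient \<open>sin (f t - f r)\<close> would then vanish.\<close>
  proof (cases "f r = f t")
    case True
    with mono have "f s = f r" by simp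
    then show thesis using gf that(1) by simp
  next
    case False
    show thesis
    proof (rule that(2))
      show "sin (f t - f r) > 0"
        using False mono diff by (intro sin_gt_zero) auto
      show "sin (f t - f s) \<ge> 0" "sin (f s - f r) \<ge> 0"
        using mono diff by (auto intro!: sin_ge_zero)
      show "sin (f t - f r) *\<^sub>R g s = sin (f t - f s) *\<^sub>R g r + sin (f s - f r) *\<^sub>R g t"
        using great_circle_combination[of "f t" "f r" "f s" u v] by (simp add: gf)
    qed
  qed
qed

text \<open>Gram-Schmidt on \<open>x\<close>, \<open>y\<close> yields the great circle. The last
  conclusion is a converse to the combination lemma: the cone spanned by \<open>x\<close> and
  \<open>y\<close> projects radially into the arc.\<close>

lemma minimal_geodesic_segment_exists:
  fixes x y :: "'a::real_inner"
  assumes xy: "norm x = 1" "norm y = 1" "x \<noteq> y" "x \<bullet> y \<ge> 0"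
  obtains g b where "minimal_geodesic_segment g 0 b" "g 0 = x" "g b = y"
    "\<And>p q. p \<ge> 0 \<Longrightarrow> q \<ge> 0 \<Longrightarrow> p *\<^sub>R x + q *\<^sub>R y \<noteq> 0 \<Longrightarrow>
       \<exists>t\<in>{0..b}. p *\<^sub>R x + q *\<^sub>R y = norm (p *\<^sub>R x + q *\<^sub>R y) *\<^sub>R g t"
proof -
  have xx: "x \<bullet> x = 1" "y \<bullet> y = 1"
    using xy by (auto simp: norm_eq_1)
  have "(x - y) \<bullet> (x - y) > 0"
    using xy by simp
  then have lt: "x \<bullet> y < 1"
    using xx by (simp add: inner_diff_left inner_diff_right inner_commute)
  define b where "b = arccos (x \<bullet> y)"
  have cosb: "cos b = x \<bullet> y"
    using lt xy by (simp add: b_def)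
  have b: "0 < b" "b \<le> pi / 2"
    using lt xy arccos_lt_bounded[of "x \<bullet> y"] arccos_le_pi2[of "x \<bullet> y"]
    by (auto simp: b_def)
  then have sinb: "sin b > 0"
    by (intro sin_gt_zero) auto
  \<comment> \<open>The part of \<open>y\<close> orthogonal to \<open>x\<close> has norm
    \<open>sin b\<close>, because its square is \<open>1 - (cos b)\<^sup>2\<close>.\<close>
  define v where "v = inverse (sin b) *\<^sub>R (y - cos b *\<^sub>R x)"
  have y: "y = cos b *\<^sub>R x + sin b *\<^sub>R v"
    using sinb by (simp add: v_def)
  have xv: "x \<bullet> v = 0"
    using xx cosb by (simp add: v_def inner_diff_right)
  have "(sin b)\<^sup>2 * (v \<bullet> v) = (sin b *\<^sub>R v) \<bullet> (sin b *\<^sub>R v)"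
    by (simp add: power2_eq_square)
  also have "sin b *\<^sub>R v = y - cos b *\<^sub>R x"
    using sinb by (simp add: v_def)
  also have "(y - cos b *\<^sub>R x) \<bullet> (y - cos b *\<^sub>R x) = 1 - (cos b)\<^sup>2"
    using xx cosb by (simp add: inner_diff_left inner_diff_right inner_commute power2_eq_square)
  also have "\<dots> = (sin b)\<^sup>2"
    by (simp add: sin_squared_eq)
  finally have vv: "v \<bullet> v = 1"
    using sinb by simp
  define g where "g t = cos t *\<^sub>R x + sin t *\<^sub>R v" for t
  show thesis
  proof (rule that)
    show g0: "g 0 = x" and gb: "g b = y"
      using y by (auto simp: g_def)
    have "\<exists>u v w. norm u = 1 \<and> norm v = 1 \<and> u \<bullet> v = 0 \<and> w \<ge> 0 \<and>
        (\<forall>t\<in>{0..b}. g t = cos (w * (t - 0)) *\<^sub>R u + sin (w * (t - 0)) *\<^sub>R v) \<and>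
        w * (b - 0) = sphere_dist (g 0) (g b)"
      using xv vv xy g0 gb
      by (intro exI[of _ x] exI[of _ v] exI[of _ 1]) (simp add: g_def norm_eq_1 sphere_dist_def b_def)
    then show "minimal_geodesic_segment g 0 b"
      using b by (simp add: minimal_geodesic_segment_def)
  next
    fix p q :: real
    assume pq: "p \<ge> 0" "q \<ge> 0" and nz: "p *\<^sub>R x + q *\<^sub>R y \<noteq> 0"
    define z where "z = p *\<^sub>R x + q *\<^sub>R y"
    define N where "N = norm z"
    have N: "N > 0" using nz by (simp add: N_def z_def)
    \<comment> \<open>These are the coordinates of the normalized \<open>z\<close> in the
      orthonormal basis \<open>x\<close>, \<open>v\<close>. Both are nonnegative, so
      \<open>arccos c\<close> is the angle of \<open>z\<close>.\<close>
    define c s where "c = (p + q * cos b) / N" and "s = q * sin b / N"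
    have z: "z = N *\<^sub>R (c *\<^sub>R x + s *\<^sub>R v)"
      using N by (simp add: z_def c_def s_def y scaleR_add_right scaleR_add_left)
    have "N\<^sup>2 = z \<bullet> z"
      by (simp add: N_def power2_norm_eq_inner)
    also have "\<dots> = N\<^sup>2 * (c\<^sup>2 + s\<^sup>2)"
      unfolding z using xx vv xv
      by (simp add: inner_add_left inner_add_right inner_commute power2_eq_square algebra_simps)
    finally have cs: "c\<^sup>2 + s\<^sup>2 = 1"
      using N by simp
    have c0: "c \<ge> 0" and s0: "s \<ge> 0"
      using N pq sinb cosb xy by (auto simp: c_def s_def)
    have c1: "c \<le> 1"
      using cs c0 by (metis abs_square_le_1 abs_of_nonneg le_add_same_cancel1 zero_le_power2)
    define t where "t = arccos c"
    have cost: "cos t = c"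
      using c0 c1 by (simp add: t_def)
    have "sin t = sqrt (1 - c\<^sup>2)"
      using c0 c1 by (simp add: t_def sin_arccos)
    also have "1 - c\<^sup>2 = s\<^sup>2"
      using cs by simp
    finally have sint: "sin t = s"
      using s0 by simp
    have t: "0 \<le> t" "t \<le> pi / 2"
      using c0 c1 arccos_lbound[of c] arccos_le_pi2[of c] by (auto simp: t_def)
    \<comment> \<open>This sine is \<open>p * sin b / N\<close>, so \<open>p \<ge> 0\<close> says
      that \<open>z\<close> does not lie beyond \<open>y\<close>: both angles are in
      \<open>{0..pi / 2}\<close>, hence \<open>t \<le> b\<close>.\<close>
    have "sin (b - t) = (sin b * (p + q * cos b) - cos b * (q * sin b)) / N"
      by (simp add: sin_diff cost sint c_def s_def diff_divide_distrib)
    also have "\<dots> = sin b * p / N"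
      by (simp add: algebra_simps)
    finally have "sin (b - t) \<ge> 0"
      using N sinb pq by simp
    then have "t \<le> b"
      using sin_gt_zero[of "t - b"] t b pi_gt_zero sin_minus[of "b - t"] by fastforce
    moreover have "z = N *\<^sub>R g t"
      by (simp add: z g_def cost sint)
    ultimately show "\<exists>t\<in>{0..b}. p *\<^sub>R x + q *\<^sub>R y = norm (p *\<^sub>R x + q *\<^sub>R y) *\<^sub>R g t"
      using t by (auto simp: z_def N_def)
  qed
qed

section \<open>Interiors of cones and spherical convexity\<close>

lemma scaleR_interior_pos_cone:
  fixes K :: "'a::euclidean_space set"
  assumes "pos_cone K" "x \<in> interior K" "c > 0"
  shows "c *\<^sub>R x \<in> interior K"
proof (rule interiorI)
  show "open ((*\<^sub>R) c ` interior K)"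
    using assms by (intro open_scaling) auto
  show "c *\<^sub>R x \<in> (*\<^sub>R) c ` interior K"
    using assms by blast
  show "(*\<^sub>R) c ` interior K \<subseteq> K"
    using assms interior_subset by (fastforce simp: pos_cone_def)
qed

text \<open>Division by \<open>p + q\<close> gives a convex combination, and scaling back stays in
  the interior.\<close>

lemma combination_interior_pos_cone:
  fixes K :: "'a::euclidean_space set"
  assumes "pos_cone K" "convex K" "x \<in> interior K" "y \<in> interior K"
    and pq: "p \<ge> 0" "q \<ge> 0" "p + q > 0"
  shows "p *\<^sub>R x + q *\<^sub>R y \<in> interior K"
proof -
  have "(p / (p + q)) *\<^sub>R x + (q / (p + q)) *\<^sub>R y \<in> interior K"
    using assms by (intro convexD) (auto simp: convex_interior simp flip: add_divide_distrib)
  from scaleR_interior_pos_cone[OF assms(1) this \<open>p + q > 0\<close>] show ?thesis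
    using pq by (simp add: scaleR_add_right)
qed

lemma inner_nonneg_subdual:
  assumes "subdual K" "x \<in> K" "y \<in> K"
  shows "x \<bullet> y \<ge> 0"
  using assms by (auto simp: subdual_def dual_cone_def)

text \<open>A ball around 0 inside \<open>K\<close> would contain a nonzero vector together with its
  negative, against pointedness. Hence points of the interior can be normalized.\<close>

lemma zero_notin_interior_proper_cone:
  fixes K :: "(real^'n) set"
  assumes "proper_cone K"
  shows "0 \<notin> interior K"
proof
  assume "0 \<in> interior K"
  then obtain e where e: "e > 0" "ball 0 e \<subseteq> K"
    by (auto simp: mem_interior)
  obtain x :: "real^'n" where x: "norm x = e / 2"
    using vector_choose_size[of "e / 2"] e by auto
  then have "x \<in> K" "- x \<in> K"
    using e by auto
  then have "x \<in> K \<inter> uminus ` K"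
    by (metis IntI imageI minus_minus)
  then have "x = 0"
    using assms by (auto simp: proper_cone_def)
  then show False
    using x e by simp
qed

text \<open>By subduality the end points have nonnegative inner product, so each point of the
  geodesic is a positive multiple of a nonnegative combination of them.\<close>

lemma spherically_convex_sphere_Int_interior:
  fixes K :: "(real^'n) set"
  assumes K: "proper_cone K" "subdual K"
  shows "spherically_convex (sphere 0 1 \<inter> interior K)"
  unfolding spherically_convex_def
proof (intro conjI ballI allI impI subsetI)
  fix x y g a b z
  assume x: "x \<in> sphere 0 1 \<inter> interior K" and y: "y \<in> sphere 0 1 \<inter> interior K"
    and g: "minimal_geodesic_segment g a b \<and> g a = x \<and> g b = y" and z: "z \<in> g ` {a..b}"
  from z obtain t where t: "t \<in> {a..b}" "z = g t"
    by auto
  have unit: "norm z = 1"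
    using g t norm_minimal_geodesic_segment by blast
  have "g a \<bullet> g b \<ge> 0"
    using g x y K interior_subset[of K] by (auto intro: inner_nonneg_subdual)
  then consider "z = x"
    | c d e where "c > 0" "d \<ge> 0" "e \<ge> 0" "c *\<^sub>R z = d *\<^sub>R x + e *\<^sub>R y"
    using minimal_geodesic_segment_combination[of g a b a t b] g t by auto
  then show "z \<in> sphere 0 1 \<inter> interior K"
  proof cases
    case 1
    then show ?thesis using x by simp
  next
    case 2
    \<comment> \<open>If \<open>d\<close> and \<open>e\<close> both vanished,
      \<open>c *\<^sub>R z\<close> would be 0, although \<open>z\<close> is a unit vector.\<close>
    then have "d + e > 0"
      using unit by (cases "d = 0 \<and> e = 0") auto
    then have "c *\<^sub>R z \<in> interior K"
      using 2 x y K by (auto simp: proper_cone_def intro: combination_interior_pos_cone)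
    then have "inverse c *\<^sub>R c *\<^sub>R z \<in> interior K"
      using K \<open>c > 0\<close> scaleR_interior_pos_cone[of K "c *\<^sub>R z" "inverse c"]
      unfolding proper_cone_def by simp
    moreover have "inverse c *\<^sub>R c *\<^sub>R z = z"
      using \<open>c > 0\<close> by simp
    ultimately show ?thesis
      using unit by simp
  qed
qed auto

section \<open>The Rayleigh quotient and the two implications\<close>

text \<open>Numerator and denominator are both homogeneous of degree 2.\<close>

lemma rayleigh_scaleR:
  assumes "c \<noteq> 0"
  shows "rayleigh A (c *\<^sub>R x) = rayleigh A x"
proof -
  have "rayleigh A (c *\<^sub>R x) = (c\<^sup>2 * ((A *v x) \<bullet> x)) / (c\<^sup>2 * (norm x)\<^sup>2)"
    by (simp add: rayleigh_def matrix_vector_mult_scaleR power_mult_distrib power2_eq_square[of c])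
  then show ?thesis
    using assms by (simp add: rayleigh_def)
qed

lemma rayleigh_unit:
  assumes "norm x = 1"
  shows "rayleigh A x = quad_form A x"
  using assms by (simp add: rayleigh_def quad_form_def)

text \<open>A point of the segment from \<open>x\<close> to \<open>y\<close> projects to the
  geodesic from \<open>sgn x\<close> to \<open>sgn y\<close>, and projecting preserves the Rayleigh
  quotient.\<close>

lemma quasiconvex_on_rayleigh_if_spherically:
  fixes K :: "(real^'n) set"
  assumes K: "proper_cone K" "subdual K"
    and f: "spherically_quasiconvex_on (sphere 0 1 \<inter> interior K) (quad_form A)"
  shows "quasiconvex_on (interior K) (rayleigh A)"
  unfolding quasiconvex_on_def
proof (intro conjI ballI allI impI)
  have cone: "pos_cone K" "convex K"
    using K by (auto simp: proper_cone_def)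
  then show conv: "convex (interior K)"
    by (simp add: convex_interior)
  fix x y and u v :: real
  assume xy: "x \<in> interior K" "y \<in> interior K" and uv: "u \<ge> 0" "v \<ge> 0" "u + v = 1"
  define z where "z = u *\<^sub>R x + v *\<^sub>R y"
  have "z \<in> interior K"
    using conv xy uv by (auto simp: z_def convexD)
  then have nz: "x \<noteq> 0" "y \<noteq> 0" "z \<noteq> 0"
    using zero_notin_interior_proper_cone[OF K(1)] xy by auto
  define x' y' where "x' = sgn x" and "y' = sgn y"
  have x': "norm x' = 1" "x' \<in> interior K" "rayleigh A x' = rayleigh A x"
    and y': "norm y' = 1" "y' \<in> interior K" "rayleigh A y' = rayleigh A y"
    using nz xy cone
    by (auto simp: x'_def y'_def norm_sgn sgn_div_norm rayleigh_scaleR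
        intro!: scaleR_interior_pos_cone)
  \<comment> \<open>The norms lost in normalizing are absorbed into the weights, which then need not
    sum to 1.\<close>
  define p q where "p = u * norm x" and "q = v * norm y"
  have pq: "p \<ge> 0" "q \<ge> 0" and z: "z = p *\<^sub>R x' + q *\<^sub>R y'"
    using uv nz by (simp_all add: p_def q_def z_def x'_def y'_def sgn_div_norm flip: divide_inverse)
  have "rayleigh A z \<le> max (rayleigh A x') (rayleigh A y')"
  \<comment> \<open>If \<open>x\<close> and \<open>y\<close> span the same ray, they determine no
    great circle; \<open>z\<close> lies on that ray and has the same quotient.\<close>
  proof (cases "x' = y'")
    case True
    then have "z = (p + q) *\<^sub>R x'"
      by (simp add: z scaleR_add_left)
    then show ?thesis
      using nz by (auto simp: rayleigh_scaleR)
  next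
    case False
    have "x' \<bullet> y' \<ge> 0"
      using x' y' K interior_subset[of K] by (auto intro: inner_nonneg_subdual)
    then obtain g b t where g: "minimal_geodesic_segment g 0 b" "g 0 = x'" "g b = y'"
      and t: "t \<in> {0..b}" "z = norm z *\<^sub>R g t"
      using minimal_geodesic_segment_exists[of x' y'] False x' y' pq nz z by metis
    have sub: "g ` {0..b} \<subseteq> sphere 0 1 \<inter> interior K"
      using f g x' y' unfolding spherically_quasiconvex_on_def spherically_convex_def by auto
    then have "quad_form A (g t) \<le> max (quad_form A (g 0)) (quad_form A (g b))"
      using f g(1) t(1) unfolding spherically_quasiconvex_on_def by blast
    moreover have "rayleigh A z = rayleigh A (g t)"
      using t(2) nz by (metis rayleigh_scaleR norm_eq_zero)
    moreover have "norm (g t) = 1"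
      using g(1) t(1) by (rule norm_minimal_geodesic_segment)
    ultimately show ?thesis
      using g x' y' by (simp add: rayleigh_unit)
  qed
  then show "rayleigh A (u *\<^sub>R x + v *\<^sub>R y) \<le> max (rayleigh A x) (rayleigh A y)"
    using x' y' by (simp add: z_def)
qed

text \<open>Up to a positive factor, a point of the arc from \<open>g r\<close> to
  \<open>g t\<close> lies on the chord between them, where quasi-convexity applies.\<close>

lemma spherically_quasiconvex_on_if_quasiconvex_rayleigh:
  fixes K :: "(real^'n) set"
  assumes K: "proper_cone K" "subdual K"
    and f: "quasiconvex_on (interior K) (rayleigh A)"
  shows "spherically_quasiconvex_on (sphere 0 1 \<inter> interior K) (quad_form A)"
  unfolding spherically_quasiconvex_on_def
proof (intro conjI allI impI ballI)
  show "spherically_convex (sphere 0 1 \<inter> interior K)"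
    using K by (rule spherically_convex_sphere_Int_interior)
  fix g :: "real \<Rightarrow> real^'n" and a b r t s
  assume g: "minimal_geodesic_segment g a b \<and> g ` {a..b} \<subseteq> sphere 0 1 \<inter> interior K"
    and rt: "{r..t} \<subseteq> {a..b}" and s: "s \<in> {r..t}"
  \<comment> \<open>The point \<open>s\<close> makes \<open>{r..t}\<close> nonempty, so the
    inclusion does bound \<open>r\<close> and \<open>t\<close>.\<close>
  have ord: "a \<le> r" "r \<le> s" "s \<le> t" "t \<le> b" "a \<le> b"
    using rt s by auto
  have C: "norm (g x) = 1" "g x \<in> interior K" if "a \<le> x" "x \<le> b" for x
    using g that by (simp_all add: image_subset_iff)
  have "g a \<bullet> g b \<ge> 0"
    using C ord K interior_subset[of K] by (auto intro!: inner_nonneg_subdual)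
  then consider "g s = g r"
    | c d e where "c > 0" "d \<ge> 0" "e \<ge> 0" "c *\<^sub>R g s = d *\<^sub>R g r + e *\<^sub>R g t"
    using minimal_geodesic_segment_combination[of g a b r s t] g ord by metis
  then show "quad_form A (g s) \<le> max (quad_form A (g r)) (quad_form A (g t))"
  proof cases
    case 1
    then show ?thesis by simp
  next
    case 2
    have "g s \<noteq> 0"
      using C(1)[of s] ord by auto
    then have de: "d + e > 0"
      using 2 by (cases "d = 0 \<and> e = 0") auto
    \<comment> \<open>Dividing the relation by \<open>d + e\<close> makes its right side a convex
      combination; the factor left on \<open>g s\<close> does not affect the quotient.\<close>
    have "rayleigh A (g s) = rayleigh A ((c / (d + e)) *\<^sub>R g s)"
      using 2 de by (simp add: rayleigh_scaleR)
    also have "(c / (d + e)) *\<^sub>R g s = inverse (d + e) *\<^sub>R (c *\<^sub>R g s)"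
      by (simp add: divide_inverse_commute)
    also have "\<dots> = (d / (d + e)) *\<^sub>R g r + (e / (d + e)) *\<^sub>R g t"
      by (simp add: 2 scaleR_add_right divide_inverse_commute)
    also have "rayleigh A \<dots> \<le> max (rayleigh A (g r)) (rayleigh A (g t))"
      using f 2 de C ord unfolding quasiconvex_on_def
      by (auto simp flip: add_divide_distrib)
    finally show ?thesis
      using C ord by (simp add: rayleigh_unit)
  qed
qed

theorem theorem2:
  fixes K :: "(real^'n) set" and A :: "real^'n^'n"
  assumes "proper_cone K" and "subdual K" and "A = transpose A"
  shows "spherically_quasiconvex_on (sphere 0 1 \<inter> interior K) (quad_form A) \<longleftrightarrow>
         quasiconvex_on (interior K) (rayleigh A)"
  using assms quasiconvex_on_rayleigh_if_spherically
    spherically_quasiconvex_on_if_quasiconvex_rayleigh by blast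

end
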